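(* Let $\rho\in\mathfrak{M}$ be a minimizer of the action $S$. Then the operator $L_\rho$ on $L^2(F,d\rho)$ defined by $$(L_\rho\psi)(x)=\int_F L(x,y)\,\psi(y)\,d\rho(y)$$ is positive (but not necessarily strictly positive), i.e. $\langle\psi,L_\rho\psi\rangle_{L^2(F,d\rho)}\ge0$ for all $\psi\in L^2(F,d\rho)$.
   Context: $F$ is a smooth compact manifold, $D\in C^\infty(F\times F,\mathbb{R})$ is symmetric ($D(x,y)=D(y,x)$) with $D(x,x)>0$ for all $x\in F$, and $L=\max(0,D)$. $\mathfrak{M}$ is the set of all normalized (total mass one) positive regular Borel measures on $F$; $S[\rho]=\iint_{F\times F}L(x,y)\,d\rho(x)\,d\rho(y)$. A minimizer is a $\rho\in\mathfrak{M}$ with $S[\rho]=\inf_{\tilde\rho\in\mathfrak{M}}S[\tilde\rho]$. *)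

theory Defs
  imports "HOL-Probability.Probability"
begin

section \<open>Smooth manifolds\<close>

text \<open>
  Differentiability of class C^k on an open set S, and smoothness. For a finite-dimensional
  domain, continuity of all directional derivatives of order at most k is the usual notion.
\<close>

primrec Ck_on :: "nat \<Rightarrow> 'e::real_normed_vector set \<Rightarrow> ('e \<Rightarrow> 'f::real_normed_vector) \<Rightarrow> bool" where
  "Ck_on 0 S f \<longleftrightarrow> continuous_on S f"
| "Ck_on (Suc k) S f \<longleftrightarrow>
     (\<forall>x\<in>S. f differentiable (at x)) \<and> (\<forall>v. Ck_on k S (\<lambda>x. frechet_derivative f (at x) v))"

definition smooth_on :: "'e::real_normed_vector set \<Rightarrow> ('e \<Rightarrow> 'f::real_normed_vector) \<Rightarrow> bool" where
  "smooth_on S f \<longleftrightarrow> (\<forall>k. Ck_on k S f)"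

text \<open>
  A chart is a pair of its domain and its coordinate map; values of the coordinate map outside
  the domain are irrelevant. The model space is a finite-dimensional normed space rather than
  a type of class \<^class>\<open>euclidean_space\<close>, because the latter has dimension at least 1 and would
  exclude zero-dimensional manifolds.
\<close>

type_synonym ('a, 'e) chart = "'a set \<times> ('a \<Rightarrow> 'e)"

definition smooth_atlas :: "('a::topological_space, 'e::real_normed_vector) chart set \<Rightarrow> bool" where
  "smooth_atlas A \<longleftrightarrow>
     (\<exists>B::'e set. finite B \<and> span B = UNIV) \<and>
     (\<forall>(U, \<phi>)\<in>A. open U \<and> open (\<phi> ` U) \<and> homeomorphism U (\<phi> ` U) \<phi> (inv_into U \<phi>)) \<and>
     (\<Union>(U, \<phi>)\<in>A. U) = UNIV \<and>
     (\<forall>(U, \<phi>)\<in>A. \<forall>(V, \<psi>)\<in>A. smooth_on (\<phi> ` (U \<inter> V)) (\<psi> \<circ> inv_into U \<phi>))"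

definition prod_atlas ::
  "('a, 'e) chart set \<Rightarrow> ('b, 'f) chart set \<Rightarrow> ('a \<times> 'b, 'e \<times> 'f) chart set" where
  "prod_atlas A B = {(U \<times> V, map_prod \<phi> \<psi>) | U \<phi> V \<psi>. (U, \<phi>) \<in> A \<and> (V, \<psi>) \<in> B}"

definition smooth_fun :: "('a, 'e::real_normed_vector) chart set \<Rightarrow> ('a \<Rightarrow> real) \<Rightarrow> bool" where
  "smooth_fun A f \<longleftrightarrow> (\<forall>(U, \<phi>)\<in>A. smooth_on (\<phi> ` U) (f \<circ> inv_into U \<phi>))"

text \<open>The manifold is a whole type; Hausdorffness and second countability are its sort.\<close>

definition compact_smooth_manifold ::
  "('a::{t2_space, second_countable_topology}, 'e::real_normed_vector) chart set \<Rightarrow> bool" where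
  "compact_smooth_manifold A \<longleftrightarrow> compact (UNIV :: 'a set) \<and> smooth_atlas A"

section \<open>The variational principle\<close>

definition regular_measure :: "'a::topological_space measure \<Rightarrow> bool" where
  "regular_measure M \<longleftrightarrow>
     (\<forall>B\<in>sets M. emeasure M B = (INF U\<in>{U. open U \<and> B \<subseteq> U}. emeasure M U) \<and>
                 emeasure M B = (SUP K\<in>{K. compact K \<and> K \<subseteq> B}. emeasure M K))"

definition normalized_measures :: "'a::topological_space measure set" where
  "normalized_measures = {\<rho>. sets \<rho> = sets borel \<and> regular_measure \<rho> \<and> emeasure \<rho> UNIV = 1}"

definition lagrangian :: "('a \<Rightarrow> 'a \<Rightarrow> real) \<Rightarrow> 'a \<Rightarrow> 'a \<Rightarrow> real" where
  "lagrangian D x y = max 0 (D x y)"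

definition action :: "('a \<Rightarrow> 'a \<Rightarrow> real) \<Rightarrow> 'a measure \<Rightarrow> real" where
  "action D \<rho> = (\<integral>y. (\<integral>x. lagrangian D x y \<partial>\<rho>) \<partial>\<rho>)"

definition minimizer :: "('a::topological_space \<Rightarrow> 'a \<Rightarrow> real) \<Rightarrow> 'a measure \<Rightarrow> bool" where
  "minimizer D \<rho> \<longleftrightarrow>
     \<rho> \<in> normalized_measures \<and> action D \<rho> = (INF \<rho>'\<in>normalized_measures. action D \<rho>')"

section \<open>Operators on the complex space of square-integrable functions\<close>

text \<open>
  Elements of L^2 are represented by functions, not by classes modulo null sets. Hence
  \<open>L2_operator\<close> demands compatibility with equality almost everywhere, and linearity holds
  almost everywhere.
\<close>

definition L2 :: "'a measure \<Rightarrow> ('a \<Rightarrow> complex) set" where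
  "L2 M = {\<psi>. \<psi> \<in> borel_measurable M \<and> integrable M (\<lambda>x. (norm (\<psi> x))\<^sup>2)}"

definition L2_inner :: "'a measure \<Rightarrow> ('a \<Rightarrow> complex) \<Rightarrow> ('a \<Rightarrow> complex) \<Rightarrow> complex" where
  "L2_inner M \<phi> \<psi> = (\<integral>x. cnj (\<phi> x) * \<psi> x \<partial>M)"

definition L2_operator :: "'a measure \<Rightarrow> (('a \<Rightarrow> complex) \<Rightarrow> ('a \<Rightarrow> complex)) \<Rightarrow> bool" where
  "L2_operator M T \<longleftrightarrow>
     (\<forall>\<psi>\<in>L2 M. T \<psi> \<in> L2 M) \<and>
     (\<forall>\<phi>\<in>L2 M. \<forall>\<psi>\<in>L2 M. (AE x in M. \<phi> x = \<psi> x) \<longrightarrow> (AE x in M. T \<phi> x = T \<psi> x)) \<and>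
     (\<forall>\<phi>\<in>L2 M. \<forall>\<psi>\<in>L2 M. \<forall>a b. AE x in M. T (\<lambda>y. a * \<phi> y + b * \<psi> y) x = a * T \<phi> x + b * T \<psi> x)"

definition positive_L2_operator :: "'a measure \<Rightarrow> (('a \<Rightarrow> complex) \<Rightarrow> ('a \<Rightarrow> complex)) \<Rightarrow> bool" where
  "positive_L2_operator M T \<longleftrightarrow>
     L2_operator M T \<and> (\<forall>\<psi>\<in>L2 M. L2_inner M \<psi> (T \<psi>) \<in> \<real>\<^sub>\<ge>\<^sub>0)"

definition lagrangian_operator ::
  "('a \<Rightarrow> 'a \<Rightarrow> real) \<Rightarrow> 'a measure \<Rightarrow> ('a \<Rightarrow> complex) \<Rightarrow> 'a \<Rightarrow> complex" where
  "lagrangian_operator D \<rho> \<psi> x = (\<integral>y. complex_of_real (lagrangian D x y) * \<psi> y \<partial>\<rho>)"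

end

theory Submission
  imports Defs
begin

text \<open>
  Let \<open>Q\<close> be the quadratic form of the kernel \<open>L\<close> on \<open>L\<^sup>2(\<rho>)\<close> and \<open>S = Q(1)\<close> the minimal action.
  Comparing \<open>\<rho>\<close> with the measures of bounded density gives \<open>Q(g) \<ge> S (\<integral>g d\<rho>)\<^sup>2\<close> for bounded
  \<open>g \<ge> 0\<close>. For bounded real \<open>f\<close> and small \<open>t > 0\<close> this applies to \<open>g = 1 + t f\<close> and to
  \<open>g = 1 - t f\<close>; the sum of the two inequalities is \<open>Q(f) \<ge> S (\<integral>f d\<rho>)\<^sup>2 \<ge> 0\<close>, so the
  Euler-Lagrange equations are not needed. Truncation gives \<open>Q(f) \<ge> 0\<close> for all integrable real \<open>f\<close>,
  and by symmetry of \<open>L\<close> a complex \<open>\<psi>\<close> contributes \<open>Q(Re \<psi>) + Q(Im \<psi>)\<close>.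
\<close>

section \<open>Bounded kernels on a probability space\<close>

text \<open>Joint measurability and a uniform bound are what the positivity argument takes from a
  continuous kernel on a compact space. Symmetry and minimality enter as hypotheses of the lemmas
  that use them.\<close>

locale bounded_kernel = prob_space M for M :: "'a measure" +
  fixes K :: "'a \<Rightarrow> 'a \<Rightarrow> real" and C :: real
  assumes kernel_measurable [measurable]: "case_prod K \<in> borel_measurable (M \<Otimes>\<^sub>M M)"
    and kernel_bounded: "\<bar>K x y\<bar> \<le> C"
begin

sublocale pair: pair_sigma_finite M M ..

lemma bound_nonneg: "0 \<le> C"
  using kernel_bounded[of undefined undefined] by linarith

text \<open>Bilinear rather than sesquilinear, and generic in the field: one form serves the real
  variation and, with the conjugate inserted by hand, the complex inner product. Integrating over
  the product makes swapping variables and dominated convergence directly applicable.\<close>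

definition bilin ::
  "('a \<Rightarrow> 'b::{real_normed_field, banach, second_countable_topology}) \<Rightarrow> ('a \<Rightarrow> 'b) \<Rightarrow> 'b" where
  "bilin f g = (\<integral>(x, y). K x y *\<^sub>R (f x * g y) \<partial>(M \<Otimes>\<^sub>M M))"

section \<open>Integrability against the kernel\<close>

lemma integrable_tensor:
  fixes f g :: "'a \<Rightarrow> 'b::{real_normed_field, banach, second_countable_topology}"
  assumes f: "integrable M f" and g: "integrable M g"
  shows "integrable (M \<Otimes>\<^sub>M M) (\<lambda>(x, y). f x * g y)"
proof (rule pair.Fubini_integrable)
  have [measurable]: "f \<in> borel_measurable M" "g \<in> borel_measurable M"
    using f g by auto
  show "(\<lambda>(x, y). f x * g y) \<in> borel_measurable (M \<Otimes>\<^sub>M M)"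
    by measurable
  show "integrable M (\<lambda>x. \<integral>y. norm (case (x, y) of (x, y) \<Rightarrow> f x * g y) \<partial>M)"
    using f by (simp add: norm_mult)
  show "AE x in M. integrable M (\<lambda>y. case (x, y) of (x, y) \<Rightarrow> f x * g y)"
    using g by simp
qed

lemma integrable_kernel_tensor:
  fixes f g :: "'a \<Rightarrow> 'b::{real_normed_field, banach, second_countable_topology}"
  assumes f: "integrable M f" and g: "integrable M g"
  shows "integrable (M \<Otimes>\<^sub>M M) (\<lambda>(x, y). K x y *\<^sub>R (f x * g y))"
proof (rule Bochner_Integration.integrable_bound)
  have [measurable]: "f \<in> borel_measurable M" "g \<in> borel_measurable M"
    using f g by auto
  show "integrable (M \<Otimes>\<^sub>M M) (\<lambda>z. C *\<^sub>R (case z of (x, y) \<Rightarrow> f x * g y))"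
    using integrable_tensor[OF f g] by simp
  show "(\<lambda>(x, y). K x y *\<^sub>R (f x * g y)) \<in> borel_measurable (M \<Otimes>\<^sub>M M)"
    by measurable
  show "AE z in M \<Otimes>\<^sub>M M. norm (case z of (x, y) \<Rightarrow> K x y *\<^sub>R (f x * g y))
      \<le> norm (C *\<^sub>R (case z of (x, y) \<Rightarrow> f x * g y))"
    using kernel_bounded bound_nonneg by (auto intro!: AE_I2 mult_right_mono)
qed

text \<open>Fubini would give this for almost every \<open>x\<close>; the uniform kernel bound gives
  it for every \<open>x\<close>, which makes the operator well behaved pointwise.\<close>

lemma integrable_kernel:
  fixes g :: "'a \<Rightarrow> 'b::{real_normed_field, banach, second_countable_topology}"
  assumes g: "integrable M g" and x: "x \<in> space M"
  shows "integrable M (\<lambda>y. K x y *\<^sub>R g y)"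
proof (rule Bochner_Integration.integrable_bound)
  show "integrable M (\<lambda>y. C *\<^sub>R g y)"
    using g by simp
  have [measurable]: "g \<in> borel_measurable M"
    using g by auto
  have [measurable]: "K x \<in> borel_measurable M"
    using measurable_Pair2[OF kernel_measurable x] by simp
  show "(\<lambda>y. K x y *\<^sub>R g y) \<in> borel_measurable M"
    by measurable
  show "AE y in M. norm (K x y *\<^sub>R g y) \<le> norm (C *\<^sub>R g y)"
    using kernel_bounded bound_nonneg by (auto intro!: AE_I2 mult_right_mono)
qed

lemma bilin_iterated:
  fixes f g :: "'a \<Rightarrow> 'b::{real_normed_field, banach, second_countable_topology}"
  assumes f: "integrable M f" and g: "integrable M g"
  shows "bilin f g = (\<integral>x. f x * (\<integral>y. K x y *\<^sub>R g y \<partial>M) \<partial>M)"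
proof -
  have "bilin f g = (\<integral>x. (\<integral>y. f x * (K x y *\<^sub>R g y) \<partial>M) \<partial>M)"
    unfolding bilin_def
    using pair.integral_fst'[OF integrable_kernel_tensor[OF f g]] by simp
  also have "\<dots> = (\<integral>x. f x * (\<integral>y. K x y *\<^sub>R g y \<partial>M) \<partial>M)"
    by (simp only: integral_mult_right_zero)
  finally show ?thesis .
qed

section \<open>Algebra of the bilinear form\<close>

lemma bilin_add_left:
  assumes "integrable M f" "integrable M g" "integrable M h"
  shows "bilin (\<lambda>x. f x + g x) h = bilin f h + bilin g h"
  unfolding bilin_def
  by (subst Bochner_Integration.integral_add[symmetric])
    (auto intro!: Bochner_Integration.integral_cong integrable_kernel_tensor assms
      simp: algebra_simps)

lemma bilin_add_right:
  assumes "integrable M f" "integrable M g" "integrable M h"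
  shows "bilin f (\<lambda>x. g x + h x) = bilin f g + bilin f h"
  unfolding bilin_def
  by (subst Bochner_Integration.integral_add[symmetric])
    (auto intro!: Bochner_Integration.integral_cong integrable_kernel_tensor assms
      simp: algebra_simps)

text \<open>A non-integrable function has integral 0, and so have its multiples; scalars therefore
  pass through the form for arbitrary functions.\<close>

lemma bilin_scale_left: "bilin (\<lambda>x. c * f x) g = c * bilin f g"
  unfolding bilin_def integral_mult_right_zero[symmetric]
  by (intro Bochner_Integration.integral_cong) (auto simp: mult.left_commute mult.assoc)

lemma bilin_scale_right: "bilin f (\<lambda>x. c * g x) = c * bilin f g"
  unfolding bilin_def integral_mult_right_zero[symmetric]
  by (intro Bochner_Integration.integral_cong) (auto simp: mult.left_commute mult.assoc)

lemma bilin_commute: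
  assumes sym: "\<And>x y. K x y = K y x" and f: "integrable M f" and g: "integrable M g"
  shows "bilin f g = bilin g f"
proof -
  have "bilin f g = (\<integral>(x, y). (case (y, x) of (x, y) \<Rightarrow> K x y *\<^sub>R (f x * g y)) \<partial>(M \<Otimes>\<^sub>M M))"
    unfolding bilin_def
    by (intro pair.integral_product_swap[symmetric] borel_measurable_integrable
        integrable_kernel_tensor f g)
  also have "\<dots> = bilin g f"
    unfolding bilin_def
    by (intro Bochner_Integration.integral_cong) (auto simp: sym mult.commute)
  finally show ?thesis .
qed

section \<open>Positivity of the quadratic form on real functions\<close>

lemma bilin_nonneg_of_bounded:
  fixes f :: "'a \<Rightarrow> real"
  assumes min: "\<And>g B. g \<in> borel_measurable M \<Longrightarrow> (\<And>x. 0 \<le> g x) \<Longrightarrow> (\<And>x. g x \<le> B) \<Longrightarrow>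
      (\<integral>x. g x \<partial>M) = 1 \<Longrightarrow> bilin (\<lambda>_. 1 :: real) (\<lambda>_. 1) \<le> bilin g g"
    and nonneg: "0 \<le> bilin (\<lambda>_. 1 :: real) (\<lambda>_. 1)"
    and [measurable]: "f \<in> borel_measurable M" and bound: "\<And>x. \<bar>f x\<bar> \<le> B"
  shows "0 \<le> bilin f f"
proof -
  define S where "S = bilin (\<lambda>_. 1 :: real) (\<lambda>_. 1)"
  define c where "c = (\<integral>x. f x \<partial>M)"
  have f: "integrable M f"
    using bound by (intro integrable_const_bound[of _ B]) auto
  \<comment> \<open>The bound on \<open>t\<close> admits both signs and keeps
    \<open>1 + t * f\<close> at least 1/2, hence a density of positive mass.\<close>
  have key: "S * (1 + t * c)\<^sup>2 \<le> S + t * (bilin (\<lambda>_. 1) f + bilin f (\<lambda>_. 1)) + t\<^sup>2 * bilin f f"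
    if t: "\<bar>t\<bar> * B \<le> 1 / 2" for t
  proof -
    define g where "g x = 1 + t * f x" for x
    define m where "m = 1 + t * c"
    have [measurable]: "g \<in> borel_measurable M"
      unfolding g_def by measurable
    have tf: "\<bar>t * f x\<bar> \<le> 1 / 2" for x
      using mult_left_mono[OF bound[of x], of "\<bar>t\<bar>"] t by (simp add: abs_mult)
    have g_bounds: "1 / 2 \<le> g x" "g x \<le> 2" for x
      using tf[of x] unfolding g_def by linarith+
    have g_int: "(\<integral>x. g x \<partial>M) = m"
      unfolding g_def m_def c_def using f by (simp add: prob_space)
    have "(\<integral>x. 1 / 2 \<partial>M) \<le> (\<integral>x. g x \<partial>M)"
      using f g_bounds by (intro integral_mono) (auto simp: g_def)
    then have m: "0 < m"
      unfolding g_int by (simp add: prob_space)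
    \<comment> \<open>Minimality concerns unit mass, so \<open>g\<close> is divided by its mass
      \<open>m\<close>; homogeneity of degree 2 then moves \<open>m\<^sup>2\<close> to the side of
      \<open>S\<close>.\<close>
    have "S \<le> bilin (\<lambda>x. inverse m * g x) (\<lambda>x. inverse m * g x)"
      unfolding S_def
    proof (rule min)
      show "0 \<le> inverse m * g x" for x
        using m g_bounds(1)[of x] by (intro mult_nonneg_nonneg) auto
      show "inverse m * g x \<le> inverse m * 2" for x
        using m g_bounds(2)[of x] by (intro mult_left_mono) auto
      show "(\<integral>x. inverse m * g x \<partial>M) = 1"
        using m g_int by simp
    qed measurable
    also have "\<dots> = (inverse m)\<^sup>2 * bilin g g"
      by (simp add: bilin_scale_left bilin_scale_right power2_eq_square)
    finally have "S * m\<^sup>2 \<le> bilin g g"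
      using m by (simp add: field_simps)
    also have "bilin g g = S + t * (bilin (\<lambda>_. 1) f + bilin f (\<lambda>_. 1)) + t\<^sup>2 * bilin f f"
      unfolding g_def S_def using f
      by (simp add: bilin_add_left bilin_add_right bilin_scale_left bilin_scale_right
          power2_eq_square algebra_simps)
    finally show ?thesis
      unfolding m_def .
  qed
  have B: "0 \<le> B"
    using bound[of undefined] by linarith
  \<comment> \<open>\<open>B + 1\<close> keeps the denominator positive when
    \<open>B = 0\<close>.\<close>
  define t where "t = 1 / (2 * (B + 1))"
  have t: "0 < t" "t * B \<le> 1 / 2"
    using B unfolding t_def by (auto simp: field_simps)
  \<comment> \<open>Adding the inequalities for \<open>t\<close> and \<open>- t\<close> cancels
    every term linear in \<open>t\<close>. The constants \<open>2 * S\<close> cancel next, leaving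
    the second-order terms.\<close>
  have "S * (1 + t * c)\<^sup>2 + S * (1 + - t * c)\<^sup>2 \<le> 2 * S + 2 * (t\<^sup>2 * bilin f f)"
    using key[of t] key[of "- t"] t by (simp add: algebra_simps)
  then have "t\<^sup>2 * (S * c\<^sup>2) \<le> t\<^sup>2 * bilin f f"
    by (simp add: power2_eq_square algebra_simps)
  moreover have "0 \<le> S * c\<^sup>2"
    using nonneg unfolding S_def by simp
  ultimately show ?thesis
    using t(1) by (smt (verit) mult_le_cancel_left_pos zero_less_power)
qed

text \<open>Truncations at height \<open>n\<close> are bounded and eventually equal \<open>f\<close>
  at each point. Since the kernel is bounded, integrability of \<open>f\<close> already makes
  \<open>C * \<bar>f x\<bar> * \<bar>f y\<bar>\<close> an integrable majorant on the
  product.\<close>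

lemma bilin_nonneg_of_integrable:
  fixes f :: "'a \<Rightarrow> real"
  assumes bounded: "\<And>(g :: 'a \<Rightarrow> real) B. g \<in> borel_measurable M \<Longrightarrow> (\<And>x. \<bar>g x\<bar> \<le> B) \<Longrightarrow> 0 \<le> bilin g g"
    and f: "integrable M f"
  shows "0 \<le> bilin f f"
proof -
  define g where "g n x = max (- real n) (min (real n) (f x))" for n x
  have [measurable]: "f \<in> borel_measurable M"
    using f by auto
  have [measurable]: "g n \<in> borel_measurable M" for n
    unfolding g_def by measurable
  have g_le: "\<bar>g n x\<bar> \<le> \<bar>f x\<bar>" for n x
    unfolding g_def by auto
  have g_lim: "(\<lambda>n. g n x) \<longlonglongrightarrow> f x" for x
  proof (rule tendsto_eventually)
    obtain N where "\<bar>f x\<bar> \<le> real N"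
      using real_arch_simple by blast
    then have "g n x = f x" if "N \<le> n" for n
      using that unfolding g_def by linarith
    then show "eventually (\<lambda>n. g n x = f x) sequentially"
      unfolding eventually_sequentially by blast
  qed
  have "(\<lambda>n. bilin (g n) (g n)) \<longlonglongrightarrow> bilin f f"
    unfolding bilin_def
  proof (rule integral_dominated_convergence)
    show "integrable (M \<Otimes>\<^sub>M M) (\<lambda>z. C * (case z of (x, y) \<Rightarrow> \<bar>f x\<bar> * \<bar>f y\<bar>))"
      using integrable_tensor[of "\<lambda>x. \<bar>f x\<bar>" "\<lambda>x. \<bar>f x\<bar>"] f by simp
    show "AE z in M \<Otimes>\<^sub>M M. (\<lambda>n. case z of (x, y) \<Rightarrow> K x y *\<^sub>R (g n x * g n y))
        \<longlonglongrightarrow> (case z of (x, y) \<Rightarrow> K x y *\<^sub>R (f x * f y))"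
      by (intro AE_I2) (auto intro!: tendsto_intros g_lim)
    show "AE z in M \<Otimes>\<^sub>M M. norm (case z of (x, y) \<Rightarrow> K x y *\<^sub>R (g n x * g n y))
        \<le> C * (case z of (x, y) \<Rightarrow> \<bar>f x\<bar> * \<bar>f y\<bar>)" for n
      by (intro AE_I2)
        (auto simp: abs_mult intro!: mult_mono kernel_bounded bound_nonneg g_le)
  qed measurable
  moreover have "0 \<le> bilin (g n) (g n)" for n
    by (rule bounded[of _ "real n"]) (auto simp: g_def)
  ultimately show ?thesis
    by (auto intro: LIMSEQ_le_const)
qed

section \<open>From the real form to the operator on complex functions\<close>

lemma bilin_cnj:
  assumes sym: "\<And>x y. K x y = K y x" and f: "integrable M f"
  shows "bilin (\<lambda>x. cnj (f x)) f =
    complex_of_real (bilin (\<lambda>x. Re (f x)) (\<lambda>x. Re (f x)) + bilin (\<lambda>x. Im (f x)) (\<lambda>x. Im (f x)))"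
proof -
  have re: "integrable M (\<lambda>x. Re (f x))" and im: "integrable M (\<lambda>x. Im (f x))"
    using f by auto
  have int: "integrable (M \<Otimes>\<^sub>M M) (\<lambda>(x, y). K x y *\<^sub>R (cnj (f x) * f y))"
    using f by (intro integrable_kernel_tensor) auto
  have "Re (bilin (\<lambda>x. cnj (f x)) f) =
      bilin (\<lambda>x. Re (f x)) (\<lambda>x. Re (f x)) + bilin (\<lambda>x. Im (f x)) (\<lambda>x. Im (f x))"
    unfolding bilin_def integral_Re[OF int, symmetric]
    by (subst Bochner_Integration.integral_add[symmetric,
          OF integrable_kernel_tensor[OF re re] integrable_kernel_tensor[OF im im]],
        intro Bochner_Integration.integral_cong) (auto simp: algebra_simps)
  \<comment> \<open>The imaginary part is a difference of two mixed terms, which agree by symmetry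
    of the kernel.\<close>
  moreover have "Im (bilin (\<lambda>x. cnj (f x)) f) =
      bilin (\<lambda>x. Re (f x)) (\<lambda>x. Im (f x)) - bilin (\<lambda>x. Im (f x)) (\<lambda>x. Re (f x))"
    unfolding bilin_def integral_Im[OF int, symmetric]
    by (subst Bochner_Integration.integral_diff[symmetric,
          OF integrable_kernel_tensor[OF re im] integrable_kernel_tensor[OF im re]],
        intro Bochner_Integration.integral_cong) (auto simp: algebra_simps)
  ultimately show ?thesis
    using bilin_commute[OF sym re im] by (simp add: complex_eq_iff)
qed

lemma L2_imp_integrable:
  assumes "\<psi> \<in> L2 M"
  shows "integrable M \<psi>"
proof -
  have [measurable]: "\<psi> \<in> borel_measurable M" and int: "integrable M (\<lambda>x. (norm (\<psi> x))\<^sup>2)"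
    using assms unfolding L2_def by blast+
  have "integrable M (\<lambda>x. norm (\<psi> x))"
    by (rule square_integrable_imp_integrable[OF _ int]) measurable
  then show ?thesis
    by (simp add: integrable_norm_iff)
qed

text \<open>The image of \<open>\<psi>\<close> is bounded by \<open>C\<close> times its L^1 norm,
  and bounded measurable functions are square integrable for a probability measure. Compatibility
  and linearity hold at every point of the space, as each defining integral converges.\<close>

lemma L2_operator_kernel: "L2_operator M (\<lambda>\<psi> x. \<integral>y. complex_of_real (K x y) * \<psi> y \<partial>M)"
  (is "L2_operator M ?T")
proof -
  have int: "integrable M (\<lambda>y. complex_of_real (K x y) * \<psi> y)"
    if "\<psi> \<in> L2 M" "x \<in> space M" for \<psi> x
    using integrable_kernel[OF L2_imp_integrable[OF that(1)] that(2)]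
    by (simp add: scaleR_conv_of_real)
  have "?T \<psi> \<in> L2 M" if \<psi>: "\<psi> \<in> L2 M" for \<psi>
  proof -
    have [measurable]: "\<psi> \<in> borel_measurable M"
      using \<psi> unfolding L2_def by simp
    have meas [measurable]: "?T \<psi> \<in> borel_measurable M"
      by measurable
    define R where "R = C * (\<integral>y. norm (\<psi> y) \<partial>M)"
    have "norm (?T \<psi> x) \<le> R" if "x \<in> space M" for x
    proof -
      have "norm (?T \<psi> x) \<le> (\<integral>y. norm (complex_of_real (K x y) * \<psi> y) \<partial>M)"
        by (rule integral_norm_bound)
      also have "\<dots> \<le> (\<integral>y. C * norm (\<psi> y) \<partial>M)"
        using int[OF \<psi> that] L2_imp_integrable[OF \<psi>] kernel_bounded
        by (intro integral_mono integrable_norm) (auto simp: norm_mult intro!: mult_right_mono)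
      finally show ?thesis
        unfolding R_def by simp
    qed
    then have "integrable M (\<lambda>x. (norm (?T \<psi> x))\<^sup>2)"
      by (intro integrable_const_bound[of _ "R\<^sup>2"]) (auto intro!: AE_I2 power_mono)
    then show ?thesis
      using meas unfolding L2_def by simp
  qed
  moreover have "AE x in M. ?T \<phi> x = ?T \<psi> x"
    if "\<phi> \<in> L2 M" "\<psi> \<in> L2 M" and eq: "AE x in M. \<phi> x = \<psi> x" for \<phi> \<psi>
  proof (rule AE_I2)
    fix x assume x: "x \<in> space M"
    show "?T \<phi> x = ?T \<psi> x"
      using eq int[OF that(1) x] int[OF that(2) x] by (intro integral_cong_AE) auto
  qed
  moreover have "AE x in M. ?T (\<lambda>y. a * \<phi> y + b * \<psi> y) x = a * ?T \<phi> x + b * ?T \<psi> x"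
    if "\<phi> \<in> L2 M" "\<psi> \<in> L2 M" for \<phi> \<psi> a b
  proof (rule AE_I2)
    fix x assume x: "x \<in> space M"
    have "?T (\<lambda>y. a * \<phi> y + b * \<psi> y) x = (\<integral>y. a * (complex_of_real (K x y) * \<phi> y)
        + b * (complex_of_real (K x y) * \<psi> y) \<partial>M)"
      by (simp add: algebra_simps)
    also have "\<dots> = a * ?T \<phi> x + b * ?T \<psi> x"
      using int[OF that(1) x] int[OF that(2) x] by simp
    finally show "?T (\<lambda>y. a * \<phi> y + b * \<psi> y) x = a * ?T \<phi> x + b * ?T \<psi> x" .
  qed
  ultimately show ?thesis
    unfolding L2_operator_def by blast
qed

text \<open>The inner product is the form at \<open>cnj \<psi>\<close> and \<open>\<psi>\<close>, so
  it splits into the real form at the real and imaginary parts. Symmetry is what makes it a real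
  number.\<close>

lemma positive_L2_operator_kernel:
  assumes sym: "\<And>x y. K x y = K y x"
    and nonneg: "\<And>f :: 'a \<Rightarrow> real. integrable M f \<Longrightarrow> 0 \<le> bilin f f"
  shows "positive_L2_operator M (\<lambda>\<psi> x. \<integral>y. complex_of_real (K x y) * \<psi> y \<partial>M)"
proof -
  have "L2_inner M \<psi> (\<lambda>x. \<integral>y. complex_of_real (K x y) * \<psi> y \<partial>M) \<in> \<real>\<^sub>\<ge>\<^sub>0" if "\<psi> \<in> L2 M" for \<psi>
  proof -
    have \<psi>: "integrable M \<psi>"
      using that by (rule L2_imp_integrable)
    have "L2_inner M \<psi> (\<lambda>x. \<integral>y. complex_of_real (K x y) * \<psi> y \<partial>M) = bilin (\<lambda>x. cnj (\<psi> x)) \<psi>"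
      unfolding L2_inner_def using \<psi>
      by (subst bilin_iterated) (simp_all add: scaleR_conv_of_real)
    then show ?thesis
      unfolding bilin_cnj[OF sym \<psi>] using \<psi> nonneg by simp
  qed
  then show ?thesis
    unfolding positive_L2_operator_def using L2_operator_kernel by blast
qed

end

section \<open>Measures with bounded density\<close>

text \<open>For finite measures, inner and outer regularity merge into smallness of the gap
  \<open>U - K\<close>. In this form regularity passes to any measure dominated by a multiple of
  \<open>M\<close>.\<close>

lemma regular_measure_iff:
  fixes M :: "'a::t2_space measure"
  assumes "finite_measure M" and sets: "sets M = sets borel"
  shows "regular_measure M \<longleftrightarrow> (\<forall>B\<in>sets M. \<forall>e>0. \<exists>K U. compact K \<and> open U \<and> K \<subseteq> B \<and> B \<subseteq> U \<and>
    measure M (U - K) < e)" (is "_ \<longleftrightarrow> ?approx")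
proof -
  interpret finite_measure M by fact
  \<comment> \<open>Hausdorffness enters here: compact sets are closed, hence Borel.\<close>
  have meas: "open U \<Longrightarrow> U \<in> sets M" "compact U \<Longrightarrow> U \<in> sets M" for U
    by (simp_all add: sets borel_compact)
  show ?thesis
  proof
    assume reg: "regular_measure M"
    show ?approx
    proof (intro ballI allI impI)
      fix B and e :: real
      assume B: "B \<in> sets M" and e: "0 < e"
      have outer: "emeasure M B = (INF U\<in>{U. open U \<and> B \<subseteq> U}. emeasure M U)"
        and inner: "emeasure M B = (SUP K\<in>{K. compact K \<and> K \<subseteq> B}. emeasure M K)"
        using reg B unfolding regular_measure_def by blast+
      obtain U where U: "open U" "B \<subseteq> U" "emeasure M U < emeasure M B + ennreal (e / 2)"
        using INF_approx_ennreal[OF _ outer, of "e / 2"] e by auto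
      obtain K where K: "compact K" "K \<subseteq> B" "emeasure M B < emeasure M K + ennreal (e / 2)"
        using SUP_approx_ennreal[OF _ _ inner, of "e / 2"] e by auto
      have "measure M U < measure M B + e / 2" "measure M B < measure M K + e / 2"
        using U(3) K(3) e
        by (auto simp: emeasure_eq_measure ennreal_less_iff simp flip: ennreal_plus)
      moreover have "measure M (U - K) = measure M U - measure M K"
        using U(2) K(2) by (intro finite_measure_Diff meas(1)[OF U(1)] meas(2)[OF K(1)]) auto
      ultimately show "\<exists>K U. compact K \<and> open U \<and> K \<subseteq> B \<and> B \<subseteq> U \<and> measure M (U - K) < e"
        using U K by (intro exI[of _ K] exI[of _ U]) auto
    qed
  next
    assume approx: ?approx
    show "regular_measure M"
      unfolding regular_measure_def
    proof (intro ballI conjI antisym)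
      fix B assume B: "B \<in> sets M"
      have approx_B: "\<exists>K U. compact K \<and> open U \<and> K \<subseteq> B \<and> B \<subseteq> U \<and>
          emeasure M U \<le> emeasure M B + ennreal e \<and> emeasure M B \<le> emeasure M K + ennreal e"
        if e: "0 < e" for e
      proof -
        obtain K U where KU: "compact K" "open U" "K \<subseteq> B" "B \<subseteq> U" "measure M (U - K) < e"
          using approx[rule_format, OF B e] by blast
        have "measure M (U - K) = measure M U - measure M K"
          using KU(3,4)
          by (intro finite_measure_Diff meas(1)[OF KU(2)] meas(2)[OF KU(1)]) auto
        moreover have "measure M K \<le> measure M B" "measure M B \<le> measure M U"
          using KU B by (auto intro!: finite_measure_mono meas(1))
        ultimately show ?thesis
          using KU e
          by (intro exI[of _ K] exI[of _ U])
            (auto simp: emeasure_eq_measure simp flip: ennreal_plus)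
      qed
      show "emeasure M B \<le> (INF U\<in>{U. open U \<and> B \<subseteq> U}. emeasure M U)"
        by (auto intro!: INF_greatest emeasure_mono meas(1))
      show "(SUP K\<in>{K. compact K \<and> K \<subseteq> B}. emeasure M K) \<le> emeasure M B"
        using B by (auto intro!: SUP_least emeasure_mono)
      show "(INF U\<in>{U. open U \<and> B \<subseteq> U}. emeasure M U) \<le> emeasure M B"
      proof (rule ennreal_le_epsilon)
        fix e :: real assume "0 < e"
        then obtain U where "open U" "B \<subseteq> U" "emeasure M U \<le> emeasure M B + ennreal e"
          using approx_B by blast
        then show "(INF U\<in>{U. open U \<and> B \<subseteq> U}. emeasure M U) \<le> emeasure M B + ennreal e"
          by (intro INF_lower2[of U]) auto
      qed
      show "emeasure M B \<le> (SUP K\<in>{K. compact K \<and> K \<subseteq> B}. emeasure M K)"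
      proof (rule ennreal_le_epsilon)
        fix e :: real assume "0 < e"
        then obtain K where K: "compact K" "K \<subseteq> B" "emeasure M B \<le> emeasure M K + ennreal e"
          using approx_B by blast
        then have "emeasure M K \<le> (SUP K\<in>{K. compact K \<and> K \<subseteq> B}. emeasure M K)"
          by (intro SUP_upper) auto
        then show "emeasure M B \<le> (SUP K\<in>{K. compact K \<and> K \<subseteq> B}. emeasure M K) + ennreal e"
          using K(3) by (meson add_right_mono order_trans)
      qed
    qed
  qed
qed

text \<open>This admits the comparison measures of the variation. A density at most \<open>B\<close>
  enlarges the measure of a gap by at most the factor \<open>B\<close>, so regularity is
  inherited.\<close>

lemma normalized_measures_density:
  fixes \<rho> :: "'a::t2_space measure" and g :: "'a \<Rightarrow> real"
  assumes \<rho>: "\<rho> \<in> normalized_measures" and [measurable]: "g \<in> borel_measurable \<rho>"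
    and nonneg: "\<And>x. 0 \<le> g x" and bound: "\<And>x. g x \<le> B" and int: "(\<integral>x. g x \<partial>\<rho>) = 1"
  shows "density \<rho> g \<in> normalized_measures"
proof -
  have sets: "sets \<rho> = sets borel" and reg: "regular_measure \<rho>" and one: "emeasure \<rho> UNIV = 1"
    using \<rho> unfolding normalized_measures_def by auto
  have space: "space \<rho> = UNIV"
    using sets_eq_imp_space_eq[OF sets] by simp
  interpret prob_space \<rho>
    by (rule prob_spaceI) (simp add: space one)
  have g: "integrable \<rho> g"
    using nonneg bound by (intro integrable_const_bound[of _ B]) auto
  have measure_density: "emeasure (density \<rho> g) A \<le> ennreal (B * measure \<rho> A)" if "A \<in> sets \<rho>" for A
  proof -
    have "emeasure (density \<rho> g) A = (\<integral>\<^sup>+x. ennreal (g x) * indicator A x \<partial>\<rho>)"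
      using that by (simp add: emeasure_density)
    also have "\<dots> \<le> (\<integral>\<^sup>+x. ennreal B * indicator A x \<partial>\<rho>)"
      using bound by (intro nn_integral_mono mult_right_mono ennreal_leI) auto
    also have "\<dots> = ennreal (B * measure \<rho> A)"
      using that order_trans[OF nonneg bound]
      by (simp add: nn_integral_cmult_indicator emeasure_eq_measure ennreal_mult')
    finally show ?thesis .
  qed
  have total: "emeasure (density \<rho> g) UNIV = 1"
    using nn_integral_eq_integral[OF g] nonneg int sets.top[of \<rho>]
    by (simp add: emeasure_density space)
  interpret density: prob_space "density \<rho> g"
    by (rule prob_spaceI) (simp add: space total)
  have sets_density: "sets (density \<rho> g) = sets borel"
    using sets by simp
  have "regular_measure (density \<rho> g)"
    unfolding regular_measure_iff[OF density.finite_measure_axioms sets_density] sets_density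
      sets[symmetric]
  proof (intro ballI allI impI)
    fix A and e :: real
    assume A: "A \<in> sets \<rho>" and e: "0 < e"
    have B: "0 \<le> B"
      using order_trans[OF nonneg bound] .
    then have "0 < e / (B + 1)"
      using e by simp
    then obtain K U where KU: "compact K" "open U" "K \<subseteq> A" "A \<subseteq> U" "measure \<rho> (U - K) < e / (B + 1)"
      using reg A unfolding regular_measure_iff[OF finite_measure_axioms sets] by meson
    have "U - K \<in> sets \<rho>"
      using KU by (simp add: sets borel_compact sets.Diff)
    then have "measure (density \<rho> g) (U - K) \<le> B * measure \<rho> (U - K)"
      using measure_density B by (simp add: density.emeasure_eq_measure)
    also have "\<dots> \<le> (B + 1) * measure \<rho> (U - K)"
      by (intro mult_right_mono) auto
    also have "\<dots> < e"
      using KU(5) B by (simp add: field_simps)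
    finally show "\<exists>K U. compact K \<and> open U \<and> K \<subseteq> A \<and> A \<subseteq> U \<and> measure (density \<rho> g) (U - K) < e"
      using KU by blast
  qed
  then show ?thesis
    unfolding normalized_measures_def using sets total by simp
qed

section \<open>Smooth functions are continuous\<close>

text \<open>Smoothness contains continuity in each product chart as its case \<open>k = 0\<close>.
  Composing with the chart map recovers \<open>f\<close> on an open set, and these sets cover the
  product.\<close>

lemma continuous_on_smooth_fun_prod_atlas:
  fixes A :: "('a::t2_space, 'e::real_normed_vector) chart set"
    and B :: "('b::t2_space, 'f::real_normed_vector) chart set"
  assumes A: "smooth_atlas A" and B: "smooth_atlas B" and f: "smooth_fun (prod_atlas A B) f"
  shows "continuous_on UNIV f"
proof -
  have "isCont f (x, y)" for x y
  proof -
    have cover: "(\<Union>(U, \<phi>)\<in>A. U) = UNIV" "(\<Union>(V, \<psi>)\<in>B. V) = UNIV"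
      using A B unfolding smooth_atlas_def by blast+
    obtain U \<phi> where U: "(U, \<phi>) \<in> A" "x \<in> U"
      using cover by blast
    obtain V \<psi> where V: "(V, \<psi>) \<in> B" "y \<in> V"
      using cover by blast
    have hom: "open U" "open V" "homeomorphism U (\<phi> ` U) \<phi> (inv_into U \<phi>)"
      "homeomorphism V (\<psi> ` V) \<psi> (inv_into V \<psi>)"
      using A B U(1) V(1) unfolding smooth_atlas_def by blast+
    have inj: "inj_on \<phi> U" "inj_on \<psi> V"
      using hom unfolding homeomorphism_def by (metis inj_on_inverseI)+
    let ?\<chi> = "map_prod \<phi> \<psi>"
    have "(U \<times> V, ?\<chi>) \<in> prod_atlas A B"
      unfolding prod_atlas_def using U V by blast
    then have "Ck_on 0 (?\<chi> ` (U \<times> V)) (f \<circ> inv_into (U \<times> V) ?\<chi>)"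
      using f unfolding smooth_fun_def smooth_on_def by blast
    then have 1: "continuous_on (?\<chi> ` (U \<times> V)) (f \<circ> inv_into (U \<times> V) ?\<chi>)"
      by simp
    have \<phi>: "continuous_on U \<phi>" and \<psi>: "continuous_on V \<psi>"
      using hom unfolding homeomorphism_def by blast+
    have "continuous_on (U \<times> V) (\<lambda>z. (\<phi> (fst z), \<psi> (snd z)))"
      by (intro continuous_on_Pair continuous_on_compose2[OF \<phi> continuous_on_fst]
          continuous_on_compose2[OF \<psi> continuous_on_snd] continuous_on_id) auto
    then have 2: "continuous_on (U \<times> V) ?\<chi>"
      by (simp add: map_prod_def case_prod_beta)
    have "continuous_on (U \<times> V) ((f \<circ> inv_into (U \<times> V) ?\<chi>) \<circ> ?\<chi>)"
      using 2 1 by (rule continuous_on_compose)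
    moreover have "((f \<circ> inv_into (U \<times> V) ?\<chi>) \<circ> ?\<chi>) z = f z" if "z \<in> U \<times> V" for z
      using inv_into_f_f[OF map_prod_inj_on[OF inj] that] by simp
    ultimately have "continuous_on (U \<times> V) f"
      by (metis (no_types, lifting) continuous_on_cong)
    then show ?thesis
      using U V hom(1,2) by (auto simp: continuous_on_eq_continuous_at open_Times)
  qed
  then show ?thesis
    by (auto intro!: continuous_at_imp_continuous_on)
qed

section \<open>Minimizers of the action\<close>

theorem lemma3p5:
  fixes A :: "('a::{t2_space, second_countable_topology}, 'e::real_normed_vector) chart set"
    and D :: "'a \<Rightarrow> 'a \<Rightarrow> real"
    and \<rho> :: "'a measure"
  assumes "compact_smooth_manifold A"
    and "smooth_fun (prod_atlas A A) (\<lambda>(x, y). D x y)"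
    and "\<And>x y. D x y = D y x"
    and "\<And>x. D x x > 0"
    and "minimizer D \<rho>"
  shows "positive_L2_operator \<rho> (lagrangian_operator D \<rho>)"
proof -
  let ?L = "lagrangian D"
  have \<rho>: "\<rho> \<in> normalized_measures"
    and sets: "sets \<rho> = sets borel" and one: "emeasure \<rho> UNIV = 1"
    using assms(5) unfolding minimizer_def normalized_measures_def by auto
  interpret prob_space \<rho>
    using sets_eq_imp_space_eq[OF sets] one by (intro prob_spaceI) simp
  have "continuous_on UNIV (\<lambda>(x, y). D x y)"
    using assms(1,2) continuous_on_smooth_fun_prod_atlas unfolding compact_smooth_manifold_def by blast
  \<comment> \<open>The maximum with 0 may destroy smoothness but preserves continuity.\<close>
  then have cont: "continuous_on UNIV (case_prod ?L)"
    unfolding lagrangian_def case_prod_beta by (intro continuous_intros)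
  have "compact (UNIV \<times> UNIV :: ('a \<times> 'a) set)"
    using assms(1) unfolding compact_smooth_manifold_def by (intro compact_Times) auto
  then have "bounded (range (case_prod ?L))"
    using cont by (intro compact_imp_bounded compact_continuous_image) auto
  then obtain C where C: "\<And>x y. \<bar>?L x y\<bar> \<le> C"
    unfolding bounded_iff by auto
  \<comment> \<open>By second countability the product of the Borel algebras is the Borel algebra of
    the product, so a continuous kernel is jointly measurable.\<close>
  have sets_prod: "sets (\<rho> \<Otimes>\<^sub>M \<rho>) = sets borel"
    using sets_pair_measure_cong[OF sets sets] by (simp only: borel_prod)
  interpret bounded_kernel \<rho> ?L C
  proof
    show "case_prod ?L \<in> borel_measurable (\<rho> \<Otimes>\<^sub>M \<rho>)"
      using borel_measurable_continuous_onI[OF cont] measurable_cong_sets[OF sets_prod refl] by blast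
  qed (rule C)
  have sym: "?L x y = ?L y x" for x y
    unfolding lagrangian_def using assms(3) by simp
  have L_nonneg: "0 \<le> ?L x y" for x y
    unfolding lagrangian_def by simp
  \<comment> \<open>Besides giving a nonnegative minimum, this bounds the actions from below, so
    that their real infimum is a genuine lower bound.\<close>
  have action_nonneg: "0 \<le> action D \<mu>" for \<mu>
    unfolding action_def using L_nonneg by (intro integral_nonneg_AE AE_I2) auto
  have action_density: "action D (density \<rho> g) = bilin g g"
    if [measurable]: "g \<in> borel_measurable \<rho>" and nonneg: "\<And>x. 0 \<le> g x" and int: "integrable \<rho> g"
    for g :: "'a \<Rightarrow> real"
  proof -
    \<comment> \<open>\<open>action\<close> integrates the first variable innermost,
      \<open>bilin_iterated\<close> the second; symmetry reconciles them.\<close>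
    have inner: "(\<integral>x. ?L x y \<partial>density \<rho> g) = (\<integral>x. ?L y x *\<^sub>R g x \<partial>\<rho>)" for y
    proof -
      have "?L y \<in> borel_measurable \<rho>"
        using measurable_Pair2[OF kernel_measurable, of y] sets_eq_imp_space_eq[OF sets] by simp
      then have "(\<integral>x. ?L y x \<partial>density \<rho> g) = (\<integral>x. g x *\<^sub>R ?L y x \<partial>\<rho>)"
        using nonneg by (intro integral_density) auto
      then show ?thesis
        by (simp only: sym[of _ y] real_scaleR_def mult.commute)
    qed
    have "(\<lambda>y. \<integral>x. ?L y x *\<^sub>R g x \<partial>\<rho>) \<in> borel_measurable \<rho>"
      by measurable
    then have "action D (density \<rho> g) = (\<integral>y. g y * (\<integral>x. ?L y x *\<^sub>R g x \<partial>\<rho>) \<partial>\<rho>)"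
      unfolding action_def inner using nonneg by (subst integral_density) auto
    also have "\<dots> = bilin g g"
      using bilin_iterated[OF int int] by simp
    finally show ?thesis .
  qed
  \<comment> \<open>The density 1 gives back \<open>\<rho>\<close> itself.\<close>
  have "action D \<rho> = bilin (\<lambda>_. 1 :: real) (\<lambda>_. 1)"
    using action_density[of "\<lambda>_. 1"] by (simp add: density_1)
  moreover have "action D \<rho> \<le> bilin g g"
    if "g \<in> borel_measurable \<rho>" "\<And>x. 0 \<le> g x" "\<And>x. g x \<le> B" "(\<integral>x. g x \<partial>\<rho>) = 1" for g B
  proof -
    have "action D \<rho> = (INF \<mu>\<in>normalized_measures. action D \<mu>)"
      using assms(5) unfolding minimizer_def by blast
    also have "\<dots> \<le> action D (density \<rho> g)"
      using action_nonneg normalized_measures_density[OF \<rho> that]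
      by (intro cINF_lower bdd_belowI2[of _ 0]) auto
    \<comment> \<open>A non-integrable \<open>g\<close> would have integral 0 instead of 1.\<close>
    also have "integrable \<rho> g"
      using that(4) not_integrable_integral_eq by fastforce
    then have "action D (density \<rho> g) = bilin g g"
      using that by (intro action_density)
    finally show ?thesis .
  qed
  ultimately have "0 \<le> bilin f f" if "integrable \<rho> f" for f :: "'a \<Rightarrow> real"
    using action_nonneg[of \<rho>] that
    by (metis bilin_nonneg_of_bounded bilin_nonneg_of_integrable)
  then show ?thesis
    using positive_L2_operator_kernel[OF sym]
    unfolding lagrangian_operator_def[abs_def] by blast
qed

end
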